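(* For every integer $n\ge 1$ there exists $m_{0}$ such that for all integers $m\ge m_{0}$, \[ p_{3^{m}}(n)\ \ge\ n+1 . \]
   Context: For a positive integer $N$, write $N=\sum_{i\ge 0}\mathrm{bit}_{i}(N)\,2^{i}$ with $\mathrm{bit}_{i}(N)\in\{0,1\}$. Let $M=\lfloor\log_{2}3^{m}\rfloor$, and consider the finite binary word $w=(\mathrm{bit}_{0}(3^{m}),\mathrm{bit}_{1}(3^{m}),\dots,\mathrm{bit}_{M-1}(3^{m}))$ of length $M$. The quantity $p_{3^{m}}(n)$ is the subword complexity of $w$ at length $n$: the number of distinct words $(w_{i},w_{i+1},\dots,w_{i+n-1})$ as the starting position $i$ ranges over $0,1,\dots,M-n$. *)

theory Defs
  imports Complex_Main
begin

text \<open>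
  Words are lists of digits 0 and 1, least significant digit first.  For positive \<open>N\<close> the
  length of the word is one less than the number of binary digits of \<open>N\<close>, so the leading
  digit, which is always 1, is left out.
\<close>

definition binary_word :: "nat \<Rightarrow> nat list" where
  "binary_word N = map (\<lambda>i. of_bool (bit N i)) [0..<nat \<lfloor>log 2 (real N)\<rfloor>]"

text \<open>
  The starting positions \<open>i\<close> satisfy \<open>0 \<le> i \<le> length w - n\<close>; with the bound written as
  \<open>i + n \<le> length w\<close>, there is none if \<open>n > length w\<close>.
\<close>

definition subwords :: "'a list \<Rightarrow> nat \<Rightarrow> 'a list set" where
  "subwords w n = {take n (drop i w) | i. i + n \<le> length w}"

definition subword_complexity :: "'a list \<Rightarrow> nat \<Rightarrow> nat" where
  "subword_complexity w n = card (subwords w n)"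

end

theory Submission
  imports Defs "HOL-Number_Theory.Cong"
begin

text \<open>
  If \<open>p(n) \<le> n\<close>, some \<open>k < n\<close> has \<open>p(k + 1) \<le> k + 1 \<le> p(k)\<close>, and the walk that the word
  describes on the graph of its factors of length \<open>k\<close> and \<open>k + 1\<close> is deterministic up to its
  last few steps.  So the word has a period \<open>d \<le> n\<close> apart from a bounded number of digits at
  both ends, which gives \<open>(2 ^ d - 1) * 3 ^ m = h * 2 ^ t + A\<close> with \<open>d, h, A\<close> bounded in terms
  of \<open>n\<close>.  For fixed \<open>d, h, A\<close>, splitting the exponents by their residues modulo 3 turns this into
  finitely many cubic Thue equations \<open>a * U ^ 3 = b * V ^ 3 + c\<close>.  Such an equation has only
  finitely many solutions: the Pade approximants of the cube root at one large solution are
  too good to be compatible with a second, much larger solution.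
\<close>

section \<open>Pade approximation of powers\<close>

text \<open>By Pascal's rule the sum for \<open>Suc n\<close> at \<open>s\<close> is the difference
  of the sums for \<open>n\<close> at \<open>s\<close> and at \<open>s + 1\<close>, and the right
  side obeys the same recursion. With \<open>s = - l - j\<close> it evaluates the sums that termwise
  integration produces.\<close>

lemma sum_choose_partial_fraction:
  fixes s :: "'a::field_char_0"
  assumes "\<And>i. s + of_nat i \<noteq> 0"
  shows "(\<Sum>i\<le>n. (-1)^i * of_nat (n choose i) / (s + of_nat i)) = fact n / pochhammer s (Suc n)"
  using assms
proof (induction n arbitrary: s)
  case (Suc n)
  define f where "f n s = (\<Sum>i\<le>n. (-1)^i * of_nat (n choose i) / (s + of_nat i))" for n and s :: 'a
  have nz: "s + 1 + of_nat i \<noteq> 0" for i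
    using Suc.prems[of "Suc i"] by (simp add: add_ac)
  have *: "f (Suc n) s = f n s - f n (s + 1)"
  proof -
    have "f (Suc n) s = 1 / s + (\<Sum>i\<le>n. (-1)^Suc i * of_nat (Suc n choose Suc i) / (s + of_nat (Suc i)))"
      unfolding f_def by (subst sum.atMost_Suc_shift) simp
    also have "\<dots> = 1 / s + (\<Sum>i\<le>n. (-1)^Suc i * of_nat (n choose Suc i) / (s + of_nat (Suc i)))
        - f n (s + 1)"
      unfolding f_def by (simp add: sum.distrib[symmetric] sum_subtractf[symmetric] algebra_simps add_divide_distrib diff_divide_distrib)
    also have "1 / s + (\<Sum>i\<le>n. (-1)^Suc i * of_nat (n choose Suc i) / (s + of_nat (Suc i)))
       = (\<Sum>i\<le>Suc n. (-1)^i * of_nat (n choose i) / (s + of_nat i))"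
      by (subst sum.atMost_Suc_shift) simp
    also have "\<dots> = f n s" by (simp add: f_def)
    finally show ?thesis .
  qed
  have "pochhammer s (Suc n) \<noteq> 0" "s + 1 + of_nat n \<noteq> 0" "pochhammer (s+1) n \<noteq> 0" "s \<noteq> 0"
    using Suc.prems nz Suc.prems[of 0]
    by (auto simp: pochhammer_eq_0_iff eq_neg_iff_add_eq_0)
  then have "fact n / pochhammer s (Suc n) - fact n / pochhammer (s + 1) (Suc n)
      = fact (Suc n) / pochhammer s (Suc (Suc n))"
    unfolding pochhammer_rec[of s "Suc n"] pochhammer_rec[of s n] pochhammer_Suc[of "s+1" n]
    by (simp add: divide_simps) (simp add: algebra_simps)
  then show ?case
    using Suc.IH[of s] Suc.IH[of "s+1"] Suc.prems nz * by (simp add: f_def)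
qed simp

text \<open>
  Coefficients of the Pade numerator of \<open>y powr (- l)\<close>; the denominator has the same
  coefficients in reverse order.  They are normalised so that for \<open>l = 2/3\<close> a factor
  \<open>9 ^ n\<close> makes them integral.
\<close>

definition thue_coeff :: "real \<Rightarrow> nat \<Rightarrow> nat \<Rightarrow> real" where
  "thue_coeff l n j = pochhammer (1 + l + real j) (n - j) / fact (n - j)
     * (pochhammer (1 - l + real (n - j)) j / fact j)"

text \<open>The first \<open>j + 1\<close> factors are those of \<open>pochhammer l (Suc j)\<close>,
  negated and in reverse order; the remaining \<open>n - j\<close> start at
  \<open>1 - l\<close>.\<close>

lemma pochhammer_neg_split:
  fixes l :: "'a::field_char_0"
  assumes "j \<le> n"
  shows "pochhammer (- l - of_nat j) (Suc n)
    = (-1) ^ Suc j * pochhammer l (Suc j) * pochhammer (1 - l) (n - j)"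
proof -
  have "pochhammer (- l - of_nat j) (Suc n)
      = pochhammer (- l - of_nat j) (Suc j) * pochhammer (- l - of_nat j + of_nat (Suc j)) (Suc n - Suc j)"
    by (rule pochhammer_product) (use assms in simp)
  also have "pochhammer (- l - of_nat j) (Suc j) = (-1) ^ Suc j * pochhammer l (Suc j)"
    using pochhammer_minus[of "l + of_nat j" "Suc j"] by (simp add: algebra_simps)
  finally show ?thesis by (simp add: algebra_simps)
qed

text \<open>Without its last factor, the left side is the coefficient of \<open>y ^ j\<close> in the
  primitive at 1 in \<open>thue_identity\<close>; that factor supplies the normalisation of
  \<open>thue_coeff\<close>.\<close>

lemma thue_coeff_partial_fraction:
  fixes l :: real
  assumes "0 < l" "l < 1" "j \<le> n"
  shows "(-1)^j * real (n choose j) * (\<Sum>i\<le>n. (-1)^i * real (n choose i) / (- l - real j + real i))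
    * (pochhammer (1 - l) n * pochhammer l (Suc n) / (fact n)\<^sup>2) = - thue_coeff l n j"
proof -
  have nz: "- l - real j + real i \<noteq> 0" for i
  proof
    assume "- l - real j + real i = 0"
    then have "l = of_int (int i - int j)" by simp
    then have "0 < int i - int j" "int i - int j < 1" using assms by linarith+
    then show False by simp
  qed
  have S: "(\<Sum>i\<le>n. (-1)^i * real (n choose i) / (- l - real j + real i))
     = fact n / ((-1) ^ Suc j * pochhammer l (Suc j) * pochhammer (1 - l) (n - j))"
    using sum_choose_partial_fraction[of "- l - real j" n, OF nz] pochhammer_neg_split[OF assms(3), of l] by simp
  have p1: "pochhammer l (Suc n) = pochhammer l (Suc j) * pochhammer (1 + l + real j) (n - j)"
    using pochhammer_product[of "Suc j" "Suc n" l] assms(3) by (simp add: add_ac)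
  have p2: "pochhammer (1 - l) n = pochhammer (1 - l) (n - j) * pochhammer (1 - l + real (n - j)) j"
    using pochhammer_product[of "n - j" n "1 - l"] assms(3) by simp
  have pos: "pochhammer l (Suc j) > 0" "pochhammer (1 - l) (n - j) > 0"
    using assms by (auto intro: pochhammer_pos)
  have sgn: "(-1)^j / (-1) ^ Suc j = (-1::real)" by simp
  have bin: "real (n choose j) = fact n / (fact j * fact (n - j))"
    using assms(3) by (rule binomial_fact)
  show ?thesis
    unfolding S p1 p2 bin thue_coeff_def using pos sgn
    by (simp add: field_simps power2_eq_square del: power_Suc)
qed

text \<open>
  The mean value theorem, applied to a primitive of \<open>(1 - u) ^ n * (u - y) ^ n * u powr (- l - n - 1)\<close>
  on \<open>[y, 1]\<close>.  Expanding both powers, the primitive at \<open>1\<close> is a polynomial in \<open>y\<close>, and at \<open>y\<close>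
  it is \<open>y powr (- l)\<close> times a polynomial in \<open>y\<close>.
\<close>

lemma thue_identity:
  fixes l y :: real
  assumes l: "0 < l" "l < 1" and y: "0 < y" "y < 1"
  obtains x where "y < x" "x < 1"
    "y powr (- l) * (\<Sum>j\<le>n. thue_coeff l n j * y ^ (n - j)) - (\<Sum>j\<le>n. thue_coeff l n j * y ^ j)
     = pochhammer (1 - l) n * pochhammer l (Suc n) / (fact n)\<^sup>2
       * ((1 - y) * ((1 - x) ^ n * (x - y) ^ n * x powr (- l - real n - 1)))"
proof -
  define c where "c i j = (-1)^i * real (n choose i) * ((-1)^j * real (n choose j)) * y ^ j" for i j
  define F where "F u = (\<Sum>i\<le>n. \<Sum>j\<le>n. c i j / (- l - real j + real i) * u powr (- l - real j + real i))" for u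
  \<comment> \<open>As \<open>l\<close> is not an integer, no exponent vanishes and the primitive
    contains no logarithm.\<close>
  have nz: "- l - real j + real i \<noteq> 0" for i j
  proof
    assume "- l - real j + real i = 0"
    then have "l = of_int (int i - int j)" by simp
    then have "0 < int i - int j" "int i - int j < 1" using l by linarith+
    then show False by simp
  qed
  have deriv: "(F has_real_derivative (1 - u) ^ n * (u - y) ^ n * u powr (- l - real n - 1)) (at u)"
    if u: "u > 0" for u
  proof -
    have "(F has_real_derivative (\<Sum>i\<le>n. \<Sum>j\<le>n. c i j * u powr (- l - real j + real i - 1))) (at u)"
      unfolding F_def using u nz
      by (auto intro!: DERIV_sum derivative_eq_intros)
    also have "(\<Sum>i\<le>n. \<Sum>j\<le>n. c i j * u powr (- l - real j + real i - 1)) =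
       (\<Sum>i\<le>n. \<Sum>j\<le>n. (real (n choose i) * (- u) ^ i * 1 ^ (n - i)) *
             (real (n choose j) * (- y) ^ j * u ^ (n - j)) * u powr (- l - real n - 1))"
    proof (intro sum.cong refl)
      fix i j assume "i \<in> {..n}" "j \<in> {..n}"
      then have "- l - real j + real i - 1 = real i + real (n - j) + (- l - real n - 1)"
        by (simp add: of_nat_diff)
      then have "u powr (- l - real j + real i - 1) = u ^ i * u ^ (n - j) * u powr (- l - real n - 1)"
        using u by (simp only: powr_add powr_realpow)
      then show "c i j * u powr (- l - real j + real i - 1) = (real (n choose i) * (- u) ^ i * 1 ^ (n - i)) *
             (real (n choose j) * (- y) ^ j * u ^ (n - j)) * u powr (- l - real n - 1)"
        unfolding c_def power_minus[of u] power_minus[of y] by simp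
    qed
    also have "\<dots> = (- u + 1) ^ n * (- y + u) ^ n * u powr (- l - real n - 1)"
      unfolding binomial_ring by (subst sum_product) (simp add: sum_distrib_right)
    finally show ?thesis by simp
  qed
  obtain x where x: "y < x" "x < 1" and Fx: "F 1 - F y = (1 - y) * ((1 - x) ^ n * (x - y) ^ n * x powr (- l - real n - 1))"
    using MVT2[of y 1 F "\<lambda>u. (1 - u) ^ n * (u - y) ^ n * u powr (- l - real n - 1)"] y deriv by auto
  define L where "L = pochhammer (1 - l) n * pochhammer l (Suc n) / (fact n :: real)\<^sup>2"
  define S where "S j = (-1)^j * real (n choose j) * (\<Sum>i\<le>n. (-1)^i * real (n choose i) / (- l - real j + real i))" for j
  have SL: "L * (S j * z) = - (thue_coeff l n j * z)" if "j \<le> n" for j z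
  proof -
    have "S j * L = - thue_coeff l n j"
      using thue_coeff_partial_fraction[OF l that] by (simp add: S_def L_def)
    moreover have "L * (S j * z) = S j * L * z" by (simp only: mult_ac)
    ultimately show ?thesis by simp
  qed
  have "F 1 = (\<Sum>j\<le>n. S j * y ^ j)"
    unfolding F_def S_def by (subst sum.swap) (simp add: c_def sum_distrib_left sum_distrib_right mult_ac)
  then have F1: "L * F 1 = - (\<Sum>j\<le>n. thue_coeff l n j * y ^ j)"
    using SL by (simp add: sum_distrib_left sum_negf[symmetric])
  have "F y = (\<Sum>i\<le>n. \<Sum>j\<le>n. (-1)^i * real (n choose i) * ((-1)^j * real (n choose j)) / (- l - real j + real i) * y powr (-l) * y ^ i)"
    unfolding F_def
  proof (intro sum.cong refl)
    fix i j
    have "y powr (- l - real j + real i) = y powr (- l) * y ^ i / y ^ j"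
      using y(1) by (simp add: powr_add powr_diff powr_realpow)
    then show "c i j / (- l - real j + real i) * y powr (- l - real j + real i) =
       (-1)^i * real (n choose i) * ((-1)^j * real (n choose j)) / (- l - real j + real i) * y powr (-l) * y ^ i"
      using y(1) by (simp add: c_def)
  qed
  \<comment> \<open>Reversing \<open>j\<close> and using \<open>i - (n - j) = j - (n - i)\<close>
    identifies the coefficient of \<open>y ^ i\<close> here with that of \<open>y ^ (n - i)\<close>
    in \<open>F 1\<close>. Hence the reversed coefficients in the denominator.\<close>
  also have "\<dots> = (\<Sum>i\<le>n. \<Sum>j\<le>n. (-1)^(n - i) * real (n choose i) * ((-1)^j * real (n choose j)) / (- l - real (n - i) + real j) * y powr (-l) * y ^ i)"
  proof (rule sum.cong[OF refl])
    fix i assume i: "i \<in> {..n}"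
    let ?g = "\<lambda>j. (-1)^i * real (n choose i) * ((-1)^j * real (n choose j)) / (- l - real j + real i) * y powr (-l) * y ^ i"
    have "sum ?g {..n} = (\<Sum>j\<le>n. ?g (n - j))"
      by (rule sum.reindex_bij_witness[of _ "\<lambda>j. n - j" "\<lambda>j. n - j"]) auto
    also have "\<dots> = (\<Sum>j\<le>n. (-1)^(n - i) * real (n choose i) * ((-1)^j * real (n choose j)) / (- l - real (n - i) + real j) * y powr (-l) * y ^ i)"
    proof (intro sum.cong refl)
      fix j assume j: "j \<in> {..n}"
      have "(-1)^i * (-1)^(n-j) = ((-1)^(n - i) * (-1) ^ j :: real)"
        using i j by (auto simp: power_add[symmetric] minus_one_power_iff)
      moreover have "real (n choose (n - j)) = real (n choose j)"
        using j by (simp add: binomial_symmetric[symmetric])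
      moreover have "- l - real (n - j) + real i = - l - real (n - i) + real j"
        using i j by (simp add: of_nat_diff)
      moreover have "?g (n - j) = ((-1)^i * (-1)^(n-j)) * (real (n choose i) * real (n choose (n-j)))
          / (- l - real (n - j) + real i) * y powr (-l) * y ^ i"
        by simp
      ultimately show "?g (n - j) = (-1)^(n - i) * real (n choose i) * ((-1)^j * real (n choose j)) / (- l - real (n - i) + real j) * y powr (-l) * y ^ i"
        by (simp only: mult_ac)
    qed
    finally show "sum ?g {..n} = \<dots>" .
  qed
  also have "\<dots> = (\<Sum>i\<le>n. S (n - i) * y powr (- l) * y ^ i)"
    unfolding S_def by (intro sum.cong refl)
     (simp add: sum_distrib_left sum_distrib_right mult_ac binomial_symmetric[symmetric])
  finally have "L * F y = - (\<Sum>i\<le>n. thue_coeff l n (n - i) * y powr (- l) * y ^ i)"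
    using SL by (simp add: sum_distrib_left sum_negf[symmetric] mult.assoc)
  also have "(\<Sum>i\<le>n. thue_coeff l n (n - i) * y powr (- l) * y ^ i) = (\<Sum>j\<le>n. thue_coeff l n j * y powr (- l) * y ^ (n - j))"
    by (rule sum.reindex_bij_witness[of _ "\<lambda>j. n - j" "\<lambda>j. n - j"]) auto
  finally have Fy: "L * F y = - (y powr (- l) * (\<Sum>j\<le>n. thue_coeff l n j * y ^ (n - j)))"
    by (simp add: sum_distrib_left mult_ac)
  have "L * (F 1 - F y) = y powr (- l) * (\<Sum>j\<le>n. thue_coeff l n j * y ^ (n - j)) - (\<Sum>j\<le>n. thue_coeff l n j * y ^ j)"
    using F1 Fy by (simp add: right_diff_distrib)
  then show thesis
    using that[OF x] Fx by (simp add: L_def)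
qed

section \<open>Integrality and size of the coefficients\<close>

lemma coprime_3_nat: "x mod 3 \<noteq> 0 \<Longrightarrow> coprime x (3::nat)"
  using prime_imp_coprime[of 3 x] by (simp add: coprime_commute mod_eq_0_iff_dvd)

text \<open>Taking one factor 3 out of each multiple of 3 in \<open>fact k\<close> leaves
  \<open>fact (k div 3)\<close> times a number prime to 3, so the induction descends from
  \<open>k\<close> to \<open>k div 3\<close>.\<close>

lemma fact_three_decomp: "\<exists>e v. fact k = 3 ^ e * (v::nat) \<and> coprime v 3 \<and> e \<le> k"
proof (induction k rule: less_induct)
  case (less k)
  have triple: "\<exists>c. fact (3 * q) = 3 ^ q * fact q * (c::nat) \<and> coprime c 3" for q
  proof (induction q)
    case (Suc q)
    then obtain c :: nat where c: "fact (3 * q) = 3 ^ q * fact q * c" "coprime c 3" by blast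
    have "fact (3 * Suc q) = 3 ^ Suc q * fact (Suc q) * (c * (3 * q + 1) * (3 * q + 2))"
    proof -
      have "3 * Suc q = Suc (Suc (Suc (3 * q)))" by simp
      then have "fact (3 * Suc q) = Suc (Suc (Suc (3 * q))) * (Suc (Suc (3 * q)) * (Suc (3 * q) * fact (3 * q)))"
        by (simp only: fact_Suc of_nat_id)
      also have "\<dots> = 3 ^ Suc q * fact (Suc q) * (c * (3 * q + 1) * (3 * q + 2))"
        unfolding c(1) by (simp add: algebra_simps)
      finally show ?thesis .
    qed
    moreover have "coprime (c * (3 * q + 1) * (3 * q + 2)) 3"
      unfolding coprime_mult_left_iff
      using c(2) coprime_3_nat[of "3 * q + 1"] coprime_3_nat[of "3 * q + 2"] by (simp add: mod_Suc)
    ultimately show ?case by blast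
  qed (use coprime_1_left in auto)
  show ?case
  proof (cases "k = 0")
    case False
    obtain c where c: "fact (3 * (k div 3)) = 3 ^ (k div 3) * fact (k div 3) * (c::nat)" "coprime c 3"
      using triple by blast
    obtain e v where e: "fact (k div 3) = 3 ^ e * (v::nat)" "coprime v 3" "e \<le> k div 3"
      using less[of "k div 3"] False by auto
    have "\<exists>w. fact k = fact (3 * (k div 3)) * (w::nat) \<and> coprime w 3"
    proof -
      have "k mod 3 < 3" by simp
      then consider "k = 3 * (k div 3)" | "k = Suc (3 * (k div 3))" | "k = Suc (Suc (3 * (k div 3)))"
        by linarith
      then show ?thesis
      proof cases
        case 1
        then show ?thesis by (intro exI[of _ 1]) simp
      next
        case 2
        have "coprime (Suc (3 * (k div 3))) 3"
          by (intro coprime_3_nat) (simp add: mod_Suc)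
        moreover have "fact (Suc (3 * (k div 3))) = fact (3 * (k div 3)) * Suc (3 * (k div 3))" by simp
        ultimately show ?thesis using 2 by metis
      next
        case 3
        have "coprime (Suc (3 * (k div 3)) * Suc (Suc (3 * (k div 3)))) 3"
          unfolding coprime_mult_left_iff
          using coprime_3_nat[of "Suc (3 * (k div 3))"] coprime_3_nat[of "Suc (Suc (3 * (k div 3)))"]
          by (simp add: mod_Suc)
        moreover have "fact (Suc (Suc (3 * (k div 3))))
           = fact (3 * (k div 3)) * (Suc (3 * (k div 3)) * Suc (Suc (3 * (k div 3))))" by (simp add: algebra_simps)
        ultimately show ?thesis using 3 by metis
      qed
    qed
    then obtain w where w: "fact k = fact (3 * (k div 3)) * (w::nat)" "coprime w 3" by blast
    have "fact k = 3 ^ (k div 3 + e) * (c * v * w)" by (simp add: w c e power_add)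
    moreover have "coprime (c * v * w) 3" using w c e by simp
    moreover have "k div 3 + e \<le> k" using e(3) by linarith
    ultimately show ?thesis by blast
  qed (auto intro!: exI[of _ 0])
qed

text \<open>Modulo \<open>v\<close> the difference \<open>d\<close> has an inverse \<open>b\<close>.
  Multiplying every factor by \<open>b\<close> gives \<open>k\<close> consecutive integers, whose
  product is divisible by \<open>fact k\<close>.\<close>

lemma fact_dvd_prod_arith_prog:
  fixes a d :: int
  assumes "coprime d v" "v dvd fact k"
  shows "v dvd (\<Prod>i<k. a + d * int i)"
proof -
  obtain b where b: "[d * b = 1] (mod v)"
    using cong_solve_coprime_int[OF assms(1)] by blast
  have "[b ^ k * (\<Prod>i<k. a + d * int i) = (\<Prod>i<k. a * b + int i)] (mod v)"
  proof -
    have "b ^ k * (\<Prod>i<k. a + d * int i) = (\<Prod>i<k. b * (a + d * int i))"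
      by (simp add: prod.distrib)
    also have "[(\<Prod>i<k. b * (a + d * int i)) = (\<Prod>i<k. a * b + int i)] (mod v)"
    proof (rule cong_prod)
      fix i
      have "[a * b + d * b * int i = a * b + 1 * int i] (mod v)"
        by (intro cong_add cong_mult b cong_refl)
      then show "[b * (a + d * int i) = a * b + int i] (mod v)" by (simp add: algebra_simps)
    qed
    finally show ?thesis .
  qed
  moreover have "v dvd (\<Prod>i<k. a * b + int i)"
  proof -
    have "fact k dvd pochhammer (a * b) k" by (rule fact_dvd_pochhammer)
    then show ?thesis using assms(2) by (simp add: pochhammer_prod atLeast0LessThan dvd_trans)
  qed
  ultimately have "v dvd b ^ k * (\<Prod>i<k. a + d * int i)"
    by (simp add: cong_dvd_iff)
  moreover have "coprime v (b ^ k)"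
    using cong_imp_coprime[OF cong_sym[OF b]] by (simp add: coprime_commute)
  ultimately show ?thesis by (simp add: coprime_dvd_mult_right_iff)
qed

text \<open>One factor \<open>3 ^ k\<close> clears the denominators of the thirds, the other absorbs
  the power of 3 in \<open>fact k\<close>. The part of \<open>fact k\<close> prime to 3 divides the
  product of the arithmetic progression.\<close>

lemma nine_power_pochhammer_thirds_int:
  "9 ^ k * (pochhammer (of_int a / 3) k / fact k) \<in> (\<int> :: real set)"
proof -
  obtain e and v :: nat where ev: "fact k = 3 ^ e * v" "coprime v 3" "e \<le> k"
    using fact_three_decomp by blast
  have v: "coprime 3 (int v)" "int v dvd fact k"
  proof -
    show "coprime 3 (int v)"
      using ev(2) coprime_int_iff[of 3 v] by (simp add: coprime_commute)
    have "(fact k :: int) = 3 ^ e * int v"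
      using arg_cong[OF ev(1), of int] by simp
    then show "int v dvd fact k" by simp
  qed
  obtain c where c: "(\<Prod>i<k. a + 3 * int i) = int v * c"
    using fact_dvd_prod_arith_prog[OF v] by blast
  have "3 ^ k * pochhammer (real_of_int a / 3) k = (\<Prod>i<k. 3 * (real_of_int a / 3 + real i))"
    by (simp only: pochhammer_prod atLeast0LessThan prod.distrib prod_constant card_lessThan)
  also have "\<dots> = real_of_int (\<Prod>i<k. a + 3 * int i)"
    by (simp add: algebra_simps)
  finally have p: "3 ^ k * pochhammer (real_of_int a / 3) k = real v * of_int c"
    by (simp add: c)
  have f: "(fact k :: real) = 3 ^ e * real v"
    using arg_cong[OF ev(1), of real] by simp
  have "v \<noteq> 0" using ev(1) by (metis fact_nonzero mult_0_right)
  have "(9::real) ^ k = 3 ^ k * (3 ^ e * 3 ^ (k - e))"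
    using ev(3) by (simp flip: power_add) (simp add: power_add flip: power_mult_distrib)
  then have "9 ^ k * (pochhammer (real_of_int a / 3) k / fact k) = 3 ^ (k - e) * of_int c"
    using p \<open>v \<noteq> 0\<close> unfolding f by (simp add: field_simps)
  then show ?thesis by simp
qed

lemma thue_coeff_nonneg:
  assumes "0 < l" "l < 1" shows "0 \<le> thue_coeff l n j"
  unfolding thue_coeff_def using assms by (intro mult_nonneg_nonneg divide_nonneg_nonneg pochhammer_nonneg) auto

lemma pochhammer_mono:
  fixes a b :: real
  assumes "0 \<le> a" "a \<le> b" shows "pochhammer a k \<le> pochhammer b k"
  unfolding pochhammer_prod using assms by (intro prod_mono) auto

lemma pochhammer_Suc_nat_div_fact:
  "pochhammer (1 + real m) k / fact k = real ((m + k) choose k)"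
proof -
  have "fact (m + k) = pochhammer (1::real) (m + k)" by (rule pochhammer_fact)
  also have "\<dots> = fact m * pochhammer (1 + real m) k"
    by (simp add: pochhammer_product' pochhammer_fact)
  finally show ?thesis
    using binomial_fact[of k "m+k", where ?'a=real] by simp
qed

text \<open>Replacing \<open>l\<close> by 1 in the first factor and by 0 in the second bounds them
  by the binomials \<open>Suc n choose (n - j)\<close> and \<open>n choose j\<close>.\<close>

lemma thue_coeff_le:
  assumes "0 < l" "l < 1" "j \<le> n"
  shows "thue_coeff l n j \<le> 2 * 4 ^ n"
proof -
  have "pochhammer (1 + l + real j) (n - j) / fact (n - j) \<le> pochhammer (1 + real (Suc j)) (n - j) / fact (n - j)"
    using assms by (intro divide_right_mono pochhammer_mono) auto
  also have "\<dots> = real (Suc n choose (n - j))"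
    using assms(3) by (subst pochhammer_Suc_nat_div_fact) simp
  also have "\<dots> \<le> 2 ^ Suc n"
    by (metis binomial_le_pow2 of_nat_le_iff of_nat_numeral of_nat_power)
  finally have 1: "pochhammer (1 + l + real j) (n - j) / fact (n - j) \<le> 2 ^ Suc n" .
  have "pochhammer (1 - l + real (n - j)) j / fact j \<le> pochhammer (1 + real (n - j)) j / fact j"
    using assms by (intro divide_right_mono pochhammer_mono) auto
  also have "\<dots> = real (n choose j)"
    using assms(3) by (subst pochhammer_Suc_nat_div_fact) simp
  also have "\<dots> \<le> 2 ^ n"
    by (metis binomial_le_pow2 of_nat_le_iff of_nat_numeral of_nat_power)
  finally have 2: "pochhammer (1 - l + real (n - j)) j / fact j \<le> 2 ^ n" .
  have "thue_coeff l n j \<le> 2 ^ Suc n * 2 ^ n"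
    unfolding thue_coeff_def using 1 2 assms
    by (intro mult_mono divide_nonneg_nonneg pochhammer_nonneg) auto
  also have "\<dots> = 2 * 4 ^ n" by (simp flip: power_mult_distrib)
  finally show ?thesis .
qed

text \<open>The two Pochhammer quotients have lengths \<open>n - j\<close> and \<open>j\<close>, so
  \<open>9 ^ n\<close> splits into exactly the powers that make each of them integral.\<close>

lemma nine_power_thue_coeff_int:
  assumes "j \<le> n" shows "9 ^ n * thue_coeff (2/3) n j \<in> \<int>"
proof -
  have "(9::real) ^ n = 9 ^ (n - j) * 9 ^ j" using assms by (simp flip: power_add)
  moreover have "real_of_int (5 + 3 * int j) / 3 = 1 + 2/3 + real j"
    "real_of_int (1 + 3 * int (n - j)) / 3 = 1 - 2/3 + real (n - j)" by simp_all
  ultimately have "9 ^ n * thue_coeff (2/3) n j =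
    (9 ^ (n - j) * (pochhammer (of_int (5 + 3 * int j) / 3) (n - j) / fact (n - j))) *
    (9 ^ j * (pochhammer (of_int (1 + 3 * int (n - j)) / 3) j / fact j))"
    unfolding thue_coeff_def by (simp only: times_divide_eq_left times_divide_eq_right mult_ac)
  then show ?thesis
    by (simp only: Ints_mult nine_power_pochhammer_thirds_int)
qed

section \<open>The cubic Thue equation\<close>

text \<open>Multiplying \<open>thue_identity\<close> by \<open>y\<close> turns
  \<open>y powr (- (2/3))\<close> into the cube root. The remainder is positive;
  \<open>1 - x\<close> and \<open>x - y\<close> are at most \<open>1 - y\<close>, while
  \<open>L\<close> and the power of \<open>x\<close> grow only geometrically because
  \<open>x > 1/2\<close>.\<close>

lemma thue_approx:
  fixes y :: real and n :: nat
  assumes y: "1/2 \<le> y" "y < 1"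
  defines "A \<equiv> (\<Sum>j\<le>n. thue_coeff (2/3) n j * y ^ j)"
    and "B \<equiv> (\<Sum>j\<le>n. thue_coeff (2/3) n j * y ^ (n - j))"
  shows "0 < B * y powr (1/3) - y * A" "B * y powr (1/3) - y * A \<le> 4 * 4 ^ n * (1 - y) ^ (2 * n + 1)"
proof -
  define L where "L = pochhammer (1 - 2/3) n * pochhammer (2/3) (Suc n) / (fact n :: real)\<^sup>2"
  obtain x where x: "y < x" "x < 1"
    and id: "y powr (- (2/3)) * B - A = L * ((1 - y) * ((1 - x) ^ n * (x - y) ^ n * x powr (- (2/3) - real n - 1)))"
    using thue_identity[of "2/3" y n thesis] y unfolding A_def B_def L_def by auto
  have "y powr (1/3) = y * y powr (- (2/3))"
    using y powr_add[of y 1 "- (2/3)"] by simp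
  then have eq: "B * y powr (1/3) - y * A = y * (y powr (- (2/3)) * B - A)"
    by (simp add: algebra_simps)
  have Lpos: "0 < L"
    unfolding L_def by (intro divide_pos_pos mult_pos_pos pochhammer_pos) auto
  have "L \<le> pochhammer 1 n * pochhammer 1 (Suc n) / (fact n)\<^sup>2"
    unfolding L_def by (intro divide_right_mono mult_mono pochhammer_mono pochhammer_nonneg) auto
  also have "\<dots> = real (Suc n)"
    by (simp add: power2_eq_square flip: pochhammer_fact)
  also have "\<dots> \<le> 2 ^ n"
    by (metis Suc_leI less_exp of_nat_le_iff of_nat_numeral of_nat_power)
  finally have L2: "L \<le> 2 ^ n" .
  have xp: "x powr (- (2/3) - real n - 1) \<le> 4 * 2 ^ n"
  proof -
    have "x powr (- (2/3) - real n - 1) \<le> (1/2) powr (- (2/3) - real n - 1)"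
      using x y by (intro powr_mono2') auto
    also have "\<dots> \<le> (1/2) powr (- real (n + 2))"
      by (intro powr_mono') auto
    also have "\<dots> = inverse ((1/2) ^ (n + 2))"
      unfolding powr_minus by (subst powr_realpow) simp_all
    also have "\<dots> = 4 * 2 ^ n" by (simp add: power_one_over)
    finally show ?thesis .
  qed
  show "0 < B * y powr (1/3) - y * A"
    unfolding eq id using x y Lpos by (intro mult_pos_pos zero_less_power) auto
  have "B * y powr (1/3) - y * A \<le> 1 * (2 ^ n * ((1 - y) * ((1 - y) ^ n * (1 - y) ^ n * (4 * 2 ^ n))))"
    unfolding eq id using x y Lpos L2 xp
    by (intro mult_mono power_mono mult_nonneg_nonneg zero_le_power) auto
  also have "\<dots> = 4 * (2 ^ n * 2 ^ n) * (1 - y) ^ (2 * n + 1)"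
    by (simp add: mult_2 power_add)
  also have "(2::real) ^ n * 2 ^ n = 4 ^ n" by (simp flip: power_mult_distrib)
  finally show "B * y powr (1/3) - y * A \<le> 4 * 4 ^ n * (1 - y) ^ (2 * n + 1)" .
qed

lemma cube_powr_third: "0 \<le> x \<Longrightarrow> (x ^ 3) powr (1/3) = (x::real)"
  by (cases "x = 0") (simp_all add: powr_powr flip: powr_numeral)

text \<open>
  With \<open>y = b * V ^ 3 / (a * U ^ 3)\<close> the root \<open>y powr (1/3)\<close> is strictly larger than the
  approximation coming from \<open>thue_approx\<close> and strictly smaller than \<open>U' * V / (V' * U)\<close>.  Hence
  the difference of these two rationals is nonzero for every \<open>n\<close>, which is why the exponent
  \<open>2/3\<close> is used rather than \<open>1/3\<close>.
\<close>

lemma cubic_solutions_repel: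
  fixes a b c U V U' V' n :: nat and E t :: real
  assumes pos: "0 < a" "0 < b" "0 < c" "0 < V" "0 < V'"
    and sol: "a * U ^ 3 = b * V ^ 3 + c" and sol': "a * U' ^ 3 = b * V' ^ 3 + c"
    and big: "2 * c \<le> a * U ^ 3"
  defines E_def: "E \<equiv> real (a * U ^ 3)" and t_def: "t \<equiv> (real b / real a) powr (1/3)"
  shows "1 \<le> 2 * E * V * c / (a * t\<^sup>2) * (72 * E) ^ n / (real V')\<^sup>2
           + 4 * U * c * V' * (36 * (real c)\<^sup>2 / E) ^ n"
proof -
  define y where "y = real b * V ^ 3 / E"
  have U: "0 < U" "0 < U'" using sol sol' pos by (auto intro: Nat.gr0I)
  have E: "0 < E" using U pos by (simp add: E_def)
  have Eeq: "E = b * V ^ 3 + c" unfolding E_def sol by simp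
  have y1: "1 - y = c / E" using E by (simp add: y_def field_simps Eeq)
  have cE: "real c / E \<le> 1 / 2"
    using big E unfolding E_def by (simp add: field_simps flip: of_nat_mult of_nat_power)
  have y: "1/2 \<le> y" "y < 1"
  proof -
    have "0 < real c / E" using pos E by simp
    then show "1/2 \<le> y" "y < 1" using y1 cE by linarith+
  qed
  define A where "A = (\<Sum>j\<le>n. thue_coeff (2/3) n j * y ^ j)"
  define B where "B = (\<Sum>j\<le>n. thue_coeff (2/3) n j * y ^ (n - j))"
  note ap = thue_approx[OF y, of n, folded A_def B_def]
  have t: "0 < t" using pos by (simp add: t_def)
  have t3: "t ^ 3 = b / a"
    using pos by (simp add: t_def powr_powr flip: powr_numeral)
  have "y = (t * V / U) ^ 3"
    using pos U by (simp add: y_def E_def power_mult_distrib power_divide t3 field_simps)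
  then have yt: "y powr (1/3) = t * V / U"
    using t by (simp add: cube_powr_third)
  have B: "0 \<le> B" "B \<le> 2 * 8 ^ n"
  proof -
    show "0 \<le> B" unfolding B_def using y by (intro sum_nonneg mult_nonneg_nonneg thue_coeff_nonneg) auto
    have "B \<le> (\<Sum>j\<le>n. 2 * 4 ^ n * 1)"
      unfolding B_def using y
      by (intro sum_mono mult_mono thue_coeff_le thue_coeff_nonneg power_le_one) auto
    also have "\<dots> = real (Suc n) * (2 * 4 ^ n)" by simp
    also have "\<dots> \<le> 2 ^ n * (2 * 4 ^ n)"
      by (intro mult_right_mono) (metis Suc_leI less_exp of_nat_le_iff of_nat_numeral of_nat_power, simp)
    also have "\<dots> = 2 * 8 ^ n" by (simp flip: power_mult_distrib)
    finally show "B \<le> 2 * 8 ^ n" .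
  qed
  define r where "r = real U' / real V'"
  have r3: "r ^ 3 = t ^ 3 + c / (a * real V' ^ 3)"
  proof -
    have "real a * U' ^ 3 = b * V' ^ 3 + c" using arg_cong[OF sol', of real] by simp
    then show ?thesis using pos by (simp add: r_def t3 power_divide field_simps)
  qed
  have rt: "t < r"
  proof (rule power_less_imp_less_base)
    show "t ^ 3 < r ^ 3" unfolding r3 using pos by simp
  qed (simp add: r_def)
  \<comment> \<open>The second solution makes \<open>r\<close> a very good approximation to
    \<open>t\<close>: \<open>r ^ 3 - t ^ 3\<close> is of order \<open>1 / V' ^ 3\<close>, and
    factoring the difference of cubes carries this over to \<open>r - t\<close>.\<close>
  have "(r - t) * t\<^sup>2 \<le> (r - t) * (r\<^sup>2 + r * t + t\<^sup>2)"
    using rt t by (intro mult_left_mono) auto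
  also have "\<dots> = r ^ 3 - t ^ 3" by (simp add: power2_eq_square power3_eq_cube algebra_simps)
  finally have rt2: "r - t \<le> c / (a * real V' ^ 3) / t\<^sup>2"
    using t mult_imp_le_div_pos[of "t\<^sup>2" "r - t" "c / (a * real V' ^ 3)"] by (simp add: r3)
  \<comment> \<open>The difference of the two rational approximations, cleared of denominators:
    \<open>9 ^ n\<close> for the coefficients, \<open>E ^ (n + 1)\<close> for the powers of
    \<open>y\<close>.\<close>
  define Z where "Z = 9 ^ n * E ^ (n + 1) * (B * (U' * V) - y * A * (V' * U))"
  have "Z \<in> \<int>"
  proof -
    have Eint: "E \<in> \<int>" by (simp add: E_def)
    have Eyint: "E * y \<in> \<int>" using E by (simp add: y_def)
    have yE: "E ^ n * y ^ j \<in> \<int>" if "j \<le> n" for j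
    proof -
      have "E ^ n * y ^ j = E ^ (n - j) * (E * y) ^ j"
        using that by (simp add: power_mult_distrib flip: power_add mult.assoc)
      then show ?thesis using Eint Eyint by simp
    qed
    have "9 ^ n * E ^ n * B = (\<Sum>j\<le>n. (9 ^ n * thue_coeff (2/3) n j) * (E ^ n * y ^ (n - j)))"
      unfolding B_def by (simp add: sum_distrib_left mult_ac)
    also have "\<dots> \<in> \<int>"
      by (intro Ints_sum Ints_mult nine_power_thue_coeff_int yE) auto
    finally have 1: "9 ^ n * E ^ n * B \<in> \<int>" .
    have "9 ^ n * E ^ n * A = (\<Sum>j\<le>n. (9 ^ n * thue_coeff (2/3) n j) * (E ^ n * y ^ j))"
      unfolding A_def by (simp add: sum_distrib_left mult_ac)
    also have "\<dots> \<in> \<int>"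
      by (intro Ints_sum Ints_mult nine_power_thue_coeff_int yE) auto
    finally have 2: "9 ^ n * E ^ n * A \<in> \<int>" .
    have "Z = (9 ^ n * E ^ n * B) * (E * (U' * V)) - (9 ^ n * E ^ n * A) * ((E * y) * (V' * U))"
      by (simp add: Z_def algebra_simps)
    then show ?thesis using 1 2 Eint Eyint by (simp add: Ints_diff Ints_mult)
  qed
  \<comment> \<open>Inserting \<open>t * V = U * y powr (1/3)\<close> separates the error of
    \<open>r\<close> from the Pade error. Neither is negative and the latter is positive, so the
    integer \<open>Z\<close> is at least 1.\<close>
  have Zeq: "Z = 9 ^ n * E ^ (n + 1) * (B * (V * V' * (r - t)) + U * V' * (B * y powr (1/3) - y * A))"
    using U pos by (simp add: Z_def yt r_def field_simps)
  have "0 < Z"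
    unfolding Zeq using E B(1) rt ap(1) U pos
    by (intro mult_pos_pos add_nonneg_pos mult_nonneg_nonneg) auto
  then have "1 \<le> Z"
    using \<open>Z \<in> \<int>\<close> by (auto elim!: Ints_cases)
  also have "Z \<le> 9 ^ n * E ^ (n + 1) * (2 * 8 ^ n * (V * V' * (c / (a * real V' ^ 3) / t\<^sup>2))
       + U * V' * (4 * 4 ^ n * (c / E) ^ (2 * n + 1)))"
    unfolding Zeq using B rt rt2 ap E y1
    by (intro mult_left_mono add_mono mult_mono) auto
  also have "\<dots> = 2 * E * V * c / (a * t\<^sup>2) * ((9 * 8 * E) ^ n) / (real V')\<^sup>2
           + 4 * U * c * V' * (9 * 4 * (real c)\<^sup>2 / E) ^ n"
    unfolding power_mult_distrib power_divide using E pos t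
    by (simp add: field_simps power2_eq_square power3_eq_cube power_add power_mult)
  finally show ?thesis by simp
qed

text \<open>Take the least \<open>n\<close> that makes the second term less than 1/2. Minimality
  bounds \<open>1 / x\<close> by a multiple of \<open>p ^ n\<close>, so the first term is at most a
  multiple of \<open>(q * p^2) ^ n\<close>, which is small once \<open>n\<close> is large.\<close>

lemma exists_balancing_exponent:
  fixes p q A B :: real
  assumes p: "0 < p" "p < 1" and q: "0 \<le> q" "q * p\<^sup>2 < 1" and A: "0 < A" and B: "0 \<le> B"
  shows "\<exists>x0. \<forall>x\<ge>x0. \<exists>n. B * q ^ n / x\<^sup>2 + A * x * p ^ n < 1"
proof -
  have "(\<lambda>n. B * (4 * A\<^sup>2 / p\<^sup>2) * (q * p\<^sup>2) ^ n) \<longlonglongrightarrow> B * (4 * A\<^sup>2 / p\<^sup>2) * 0"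
    using p q by (intro tendsto_intros LIMSEQ_realpow_zero) auto
  then have "\<forall>\<^sub>F n in sequentially. B * (4 * A\<^sup>2 / p\<^sup>2) * (q * p\<^sup>2) ^ n < 1/2"
    by (intro order_tendstoD(2)[where y = 0]) auto
  then obtain n0 where n0: "\<And>n. n \<ge> n0 \<Longrightarrow> B * (4 * A\<^sup>2 / p\<^sup>2) * (q * p\<^sup>2) ^ n < 1/2"
    by (auto simp: eventually_sequentially)
  show ?thesis
  \<comment> \<open>From this threshold on, exponents up to \<open>n0\<close> leave the second term
    at 1/2 or more, which forces the least exponent beyond \<open>n0\<close>.\<close>
  proof (intro exI[of _ "1 / (2 * A * p ^ n0)"] allI impI)
    fix x assume x: "1 / (2 * A * p ^ n0) \<le> x"
    have xpos: "0 < x" using x A p by (meson divide_pos_pos mult_pos_pos less_le_trans zero_less_numeral zero_less_one zero_less_power)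
    have "\<exists>n. p ^ n < 1 / (2 * A * x)"
      using real_arch_pow_inv[of "1 / (2 * A * x)" p] A p xpos by auto
    then have ex: "\<exists>n. 2 * A * x * p ^ n < 1"
      using A xpos by (auto simp: field_simps)
    define n where "n = (LEAST n. 2 * A * x * p ^ n < 1)"
    have n: "2 * A * x * p ^ n < 1" unfolding n_def using ex by (rule LeastI_ex)
    have "n0 < n"
    proof (rule ccontr)
      assume "\<not> n0 < n"
      then have "2 * A * x * p ^ n0 \<le> 2 * A * x * p ^ n"
        using p A xpos by (intro mult_left_mono power_decreasing) auto
      moreover have "1 \<le> 2 * A * x * p ^ n0" using x A p by (simp add: field_simps)
      ultimately show False using n by simp
    qed
    then obtain m where m: "n = Suc m" by (cases n) auto
    then have "\<not> 2 * A * x * p ^ m < 1"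
      using not_less_Least[of m "\<lambda>n. 2 * A * x * p ^ n < 1"] by (simp add: m flip: n_def)
    then have "1 \<le> (2 * A * x * p ^ m)\<^sup>2" by simp
    then have "1 / x\<^sup>2 \<le> 4 * A\<^sup>2 / p\<^sup>2 * (p\<^sup>2) ^ n"
      using xpos p by (simp add: m field_simps power2_eq_square power_mult_distrib)
    then have "B * q ^ n * (1 / x\<^sup>2) \<le> B * q ^ n * (4 * A\<^sup>2 / p\<^sup>2 * (p\<^sup>2) ^ n)"
      using B q by (intro mult_left_mono) auto
    also have "\<dots> = B * (4 * A\<^sup>2 / p\<^sup>2) * (q * p\<^sup>2) ^ n" by (simp add: power_mult_distrib)
    also have "\<dots> < 1/2" using n0 \<open>n0 < n\<close> by simp
    finally have "B * q ^ n / x\<^sup>2 < 1/2" by simp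
    moreover have "A * x * p ^ n < 1/2" using n by simp
    ultimately have "B * q ^ n / x\<^sup>2 + A * x * p ^ n < 1" by linarith
    then show "\<exists>n. B * q ^ n / x\<^sup>2 + A * x * p ^ n < 1" ..
  qed
qed

text \<open>Since \<open>V\<close> determines \<open>U\<close>, an infinite solution set has
  unbounded \<open>V\<close>. Fix one large solution; for a much larger \<open>V'\<close>, the
  balancing exponent makes the lower bound of \<open>cubic_solutions_repel\<close> fail.\<close>

lemma finite_cubic_thue_solutions:
  fixes a b c :: nat
  assumes pos: "0 < a" "0 < b" "0 < c"
  shows "finite {(U, V). a * U ^ 3 = b * V ^ 3 + c}"
proof (rule ccontr)
  let ?S = "{(U, V). a * U ^ 3 = b * V ^ 3 + c}"
  assume inf: "infinite ?S"
  have "inj_on snd ?S"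
    using pos by (auto simp: inj_on_def) (metis mult_left_cancel less_not_refl power_eq_iff_eq_base zero_le zero_less_numeral)
  then have "infinite (snd ` ?S)" using inf finite_imageD by blast
  then have unb: "\<exists>U V. N < V \<and> a * U ^ 3 = b * V ^ 3 + c" for N
    unfolding finite_nat_set_iff_bounded_le by (fastforce simp: not_le)
  \<comment> \<open>The term \<open>2 * c\<close> yields \<open>big\<close>; the other makes
    \<open>q * p^2 < 1\<close> for \<open>p = 36 * c^2 / E\<close> and \<open>q = 72 * E\<close>, as
    \<open>E\<close> is at least \<open>V\<close>.\<close>
  obtain U V where UV: "2 * c + 72 * 36\<^sup>2 * c ^ 4 < V" "a * U ^ 3 = b * V ^ 3 + c"
    using unb by blast
  define E where "E = real (a * U ^ 3)"
  have "V \<le> b * V ^ 3"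
    using pos UV(1) by (simp add: power3_eq_cube)
  then have VE: "real V \<le> E" by (simp add: E_def UV(2) del: of_nat_mult of_nat_power of_nat_add)
  have big: "2 * c \<le> a * U ^ 3" using \<open>V \<le> b * V ^ 3\<close> UV by linarith
  have V0: "0 < V" using UV(1) by simp
  have E0: "0 < E" using VE V0 by linarith
  have "real (72 * 36\<^sup>2 * c ^ 4) < real V" using UV(1) by linarith
  then have E: "72 * 36\<^sup>2 * real c ^ 4 < E" using VE by simp
  have c1: "1 \<le> real c" using pos(3) by simp
  have "36 * (real c)\<^sup>2 \<le> 72 * 36\<^sup>2 * real c ^ 4"
  proof -
    have "(real c)\<^sup>2 \<le> real c ^ 4" using c1 by (intro power_increasing) auto
    moreover have "0 \<le> real c ^ 4" by simp
    ultimately have "36 * (real c)\<^sup>2 \<le> 72 * 1296 * real c ^ 4" by linarith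
    then show ?thesis by simp
  qed
  then have p: "0 < 36 * (real c)\<^sup>2 / E" "36 * (real c)\<^sup>2 / E < 1"
    using E E0 pos by (auto simp: field_simps)
  have "72 * E * (36 * (real c)\<^sup>2 / E)\<^sup>2 = 72 * 36\<^sup>2 * real c ^ 4 / E"
    using E0 by (simp add: field_simps power2_eq_square power4_eq_xxxx)
  also have "\<dots> < 1" using E E0 by simp
  finally have qp: "72 * E * (36 * (real c)\<^sup>2 / E)\<^sup>2 < 1" .
  have U0: "0 < U" using UV(2) pos by (auto intro: Nat.gr0I)
  define t where "t = (real b / real a) powr (1/3)"
  have "\<exists>x0::real. \<forall>x\<ge>x0. \<exists>n. 2 * E * V * c / (a * t\<^sup>2) * (72 * E) ^ n / x\<^sup>2
      + 4 * real U * c * x * (36 * (real c)\<^sup>2 / E) ^ n < (1::real)"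
    using E0 U0 pos by (intro exists_balancing_exponent p qp) auto
  then obtain x0 :: real where x0: "\<And>x. x \<ge> x0 \<Longrightarrow> \<exists>n. 2 * E * V * c / (a * t\<^sup>2) * (72 * E) ^ n / x\<^sup>2
      + 4 * real U * c * x * (36 * (real c)\<^sup>2 / E) ^ n < (1::real)"
    by blast
  obtain U' V' where UV': "nat \<lceil>x0\<rceil> < V'" "a * U' ^ 3 = b * V' ^ 3 + c"
    using unb by blast
  have "x0 \<le> real V'" using UV'(1) by linarith
  then obtain n where "2 * E * V * c / (a * t\<^sup>2) * (72 * E) ^ n / (real V')\<^sup>2
      + 4 * real U * c * V' * (36 * (real c)\<^sup>2 / E) ^ n < 1"
    using x0 by blast
  moreover have "0 < V'" using UV'(1) by simp
  ultimately show False
    using cubic_solutions_repel[OF pos V0 _ UV(2) UV'(2) big, of n] unfolding E_def t_def by simp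
qed

lemma finite_exponential_solutions:
  fixes a b c p q :: nat
  assumes pos: "0 < a" "0 < b" "0 < c" and pq: "2 \<le> p" "2 \<le> q"
  shows "finite {(m, k). a * p ^ m = b * q ^ k + c}"
proof -
  let ?S = "\<lambda>i j. {(U, V). a * p ^ i * U ^ 3 = b * q ^ j * V ^ 3 + c}"
  let ?h = "\<lambda>(m, k). (m mod 3, k mod 3, p ^ (m div 3), q ^ (k div 3))"
  have fin: "finite (?S i j)" for i j
    using finite_cubic_thue_solutions[of "a * p ^ i" "b * q ^ j" c] pos pq by simp
  have inj: "inj ?h"
    using pq by (auto simp: inj_on_def power_inject_exp) (metis div_mult_mod_eq)+
  have "?h ` {(m, k). a * p ^ m = b * q ^ k + c} \<subseteq> (SIGMA i:{..<3}. SIGMA j:{..<3}. ?S i j)"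
  proof safe
    fix m k assume eq: "a * p ^ m = b * q ^ k + c"
    have "p ^ m = p ^ (m mod 3) * (p ^ (m div 3)) ^ 3" "q ^ k = q ^ (k mod 3) * (q ^ (k div 3)) ^ 3"
      by (simp_all flip: power_mult power_add)
    then show "a * p ^ (m mod 3) * (p ^ (m div 3)) ^ 3 = b * q ^ (k mod 3) * (q ^ (k div 3)) ^ 3 + c"
      using eq by (simp add: mult.assoc)
  qed auto
  moreover have "finite (SIGMA i:{..<3::nat}. SIGMA j:{..<3::nat}. ?S i j)"
    using fin by (intro finite_SigmaI) auto
  ultimately have "finite (?h ` {(m, k). a * p ^ m = b * q ^ k + c})"
    by (rule finite_subset)
  then show ?thesis
    by (rule finite_imageD) (use inj in \<open>auto intro: inj_on_subset\<close>)
qed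

section \<open>Words of low complexity\<close>

text \<open>
  Here \<open>f\<close> lists the vertices and \<open>e\<close> the edges of a walk.  If the last vertex occurred before,
  then every vertex has an outgoing edge, and the cardinalities leave room for only one.
  Otherwise dropping the last step removes exactly one vertex and one edge.
\<close>

lemma card_le_card_imp_deterministic_prefix:
  fixes e :: "nat \<Rightarrow> 'e" and f :: "nat \<Rightarrow> 'v"
  assumes "\<And>i j. e i = e j \<Longrightarrow> f i = f j \<and> f (Suc i) = f (Suc j)"
    and "card (e ` {..<N}) \<le> n" "n \<le> card (f ` {..N})"
  shows "\<exists>N'\<le>N. N \<le> N' + n \<and> (\<forall>i<N'. \<forall>j<N'. f i = f j \<longrightarrow> e i = e j)"
  using assms(2,3)
proof (induction N arbitrary: n)
  case (Suc N)
  show ?case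
  proof (cases "f (Suc N) \<in> f ` {..<Suc N}")
    case True
    then have fV: "f ` {..Suc N} = f ` {..<Suc N}"
      by (auto simp: lessThan_Suc_atMost atMost_Suc)
    \<comment> \<open>\<open>g\<close> sends an edge to its initial vertex, independently of the
      chosen occurrence. It maps onto the vertices, which are at least as many as the edges, so it
      is injective.\<close>
    define g where "g x = f (inv_into {..<Suc N} e x)" for x
    have g: "g (e i) = f i" if "i < Suc N" for i
      unfolding g_def by (metis assms(1) f_inv_into_f imageI lessThan_iff that)
    have img: "g ` e ` {..<Suc N} = f ` {..<Suc N}"
      by (rule set_eqI) (auto simp: image_iff g)
    have "card (g ` e ` {..<Suc N}) \<ge> card (e ` {..<Suc N})"
      using Suc.prems fV img by simp
    then have "inj_on g (e ` {..<Suc N})"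
      by (metis card_image_le eq_card_imp_inj_on finite_imageI finite_lessThan le_antisym)
    then have "\<forall>i<Suc N. \<forall>j<Suc N. f i = f j \<longrightarrow> e i = e j"
      by (metis g imageI inj_onD lessThan_iff)
    then show ?thesis by (intro exI[of _ "Suc N"] conjI) (assumption | simp)+
  next
    case False
    \<comment> \<open>A repeated last edge would repeat its end vertex.\<close>
    have "e N \<notin> e ` {..<N}"
    proof
      assume "e N \<in> e ` {..<N}"
      then obtain i where "i < N" "e N = e i" by auto
      then have "f (Suc N) = f (Suc i)" "Suc i < Suc N" using assms(1)[of N i] by auto
      then show False using False by auto
    qed
    then have cE: "card (e ` {..<Suc N}) = Suc (card (e ` {..<N}))"
      by (simp add: lessThan_Suc)
    have cV: "card (f ` {..Suc N}) = Suc (card (f ` {..N}))"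
      using False by (simp add: atMost_Suc lessThan_Suc_atMost)
    obtain N' where "N' \<le> N" "N \<le> N' + (n - 1)" "\<forall>i<N'. \<forall>j<N'. f i = f j \<longrightarrow> e i = e j"
    proof -
      have "card (e ` {..<N}) \<le> n - 1" "n - 1 \<le> card (f ` {..N})"
        using Suc.prems cE cV by linarith+
      from Suc.IH[OF this] show ?thesis using that by blast
    qed
    moreover have "n \<ge> 1" using Suc.prems cE by simp
    ultimately show ?thesis by (intro exI[of _ N'] conjI) (assumption | linarith)+
  qed
qed auto

text \<open>Among the \<open>n + 1\<close> edges \<open>e 0, ..., e n\<close> two coincide.
  Determinism propagates this coincidence along the walk up to \<open>N'\<close>, and the distance
  of the two indices is the period.\<close>

lemma card_le_card_imp_periodic:
  fixes e :: "nat \<Rightarrow> 'e" and f :: "nat \<Rightarrow> 'v"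
  assumes step: "\<And>i j. e i = e j \<Longrightarrow> f i = f j \<and> f (Suc i) = f (Suc j)"
    and E: "card (e ` {..<N}) \<le> n" and V: "n \<le> card (f ` {..N})" and N: "2 * n < N"
  shows "\<exists>d N'. 1 \<le> d \<and> d \<le> n \<and> N \<le> N' + n \<and> (\<forall>i\<ge>n. i + d < N' \<longrightarrow> e i = e (i + d))"
proof -
  obtain N' where N': "N' \<le> N" "N \<le> N' + n" and det: "\<And>i j. i < N' \<Longrightarrow> j < N' \<Longrightarrow> f i = f j \<Longrightarrow> e i = e j"
    using card_le_card_imp_deterministic_prefix[of e f, OF step E V] by blast
  have "card (e ` {..n}) \<le> card (e ` {..<N})"
    using N N' by (intro card_mono) auto
  then have "\<not> inj_on e {..n}"
    using E card_image[of e "{..n}"] by auto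
  then obtain i j where ij: "i < j" "j \<le> n" "e i = e j"
    unfolding inj_on_def by (metis atMost_iff linorder_neqE_nat)
  have *: "e (i + k) = e (j + k)" if "j + k < N'" for k
    using that
  proof (induction k)
    case (Suc k)
    then show ?case
      using step[of "i + k" "j + k"] det[of "i + Suc k" "j + Suc k"] ij by simp
  qed (use ij in simp)
  show ?thesis
  proof (rule exI[of _ "j - i"], rule exI[of _ N'], intro conjI allI impI)
    fix q assume "q \<ge> n" "q + (j - i) < N'"
    moreover have "i + (q - i) = q" "j + (q - i) = q + (j - i)"
      using \<open>q \<ge> n\<close> ij by linarith+
    ultimately show "e q = e (q + (j - i))"
      using *[of "q - i"] by metis
  qed (use ij N' in auto)
qed

lemma subwords_eq_image:
  assumes "n \<le> length w"
  shows "subwords w n = (\<lambda>i. map ((!) w) [i..<i + n]) ` {..length w - n}"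
proof -
  have "take n (drop i w) = map ((!) w) [i..<i + n]" if "i + n \<le> length w" for i
    using that by (intro nth_equalityI) auto
  then show ?thesis
    unfolding subwords_def using assms by (auto simp: image_iff) (metis le_diff_conv2)+
qed

lemma map_nth_upt_eq_iff:
  "map ((!) w) [i..<i + k] = map ((!) w) [j..<j + k] \<longleftrightarrow> (\<forall>m<k. w ! (i + m) = w ! (j + m))"
  by (auto simp: list_eq_iff_nth_eq)

lemma subword_complexity_0 [simp]: "subword_complexity w 0 = 1"
proof -
  have "subwords w 0 = {[]}" unfolding subwords_def by auto
  then show ?thesis by (simp add: subword_complexity_def)
qed

lemma low_complexity_imp_periodic:
  assumes n: "1 \<le> n" and low: "subword_complexity w n \<le> n" and len: "3 * n < length w"
  shows "\<exists>d. 1 \<le> d \<and> d \<le> n \<and> (\<forall>i. n \<le> i \<and> i + d + 2 * n < length w \<longrightarrow> w ! i = w ! (i + d))"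
proof -
  define k where "k = (LEAST k. subword_complexity w (Suc k) \<le> Suc k)"
  have ex: "subword_complexity w (Suc (n - 1)) \<le> Suc (n - 1)" using n low by simp
  have k: "subword_complexity w (Suc k) \<le> Suc k"
    unfolding k_def by (rule LeastI, rule ex)
  have kn: "Suc k \<le> n"
    using Least_le[of "\<lambda>k. subword_complexity w (Suc k) \<le> Suc k", OF ex] n unfolding k_def by simp
  \<comment> \<open>For positive \<open>k\<close> this is minimality; for \<open>k = 0\<close> the
    empty word is the one factor.\<close>
  have k': "Suc k \<le> subword_complexity w k"
  proof (cases k)
    case (Suc k0)
    then show ?thesis
      using not_less_Least[of k0 "\<lambda>k. subword_complexity w (Suc k) \<le> Suc k"] unfolding k_def by simp
  qed simp
  let ?f = "\<lambda>i. map ((!) w) [i..<i + k]" and ?e = "\<lambda>i. map ((!) w) [i..<i + Suc k]"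
  have step: "?f i = ?f j \<and> ?f (Suc i) = ?f (Suc j)" if "?e i = ?e j" for i j
    using that unfolding map_nth_upt_eq_iff by (auto dest: spec[of _ "Suc _"])
  define N where "N = length w - k"
  have "{..length w - Suc k} = {..<N}" using kn len by (auto simp: N_def)
  then have "card (?e ` {..<N}) \<le> Suc k" "Suc k \<le> card (?f ` {..N})"
    using k k' kn len subwords_eq_image[of "Suc k" w] subwords_eq_image[of k w]
    by (simp_all add: subword_complexity_def N_def)
  moreover have "2 * Suc k < N" using kn len by (simp add: N_def)
  ultimately obtain d N' where d: "1 \<le> d" "d \<le> Suc k" "N \<le> N' + Suc k"
    and per: "\<And>i. Suc k \<le> i \<Longrightarrow> i + d < N' \<Longrightarrow> ?e i = ?e (i + d)"
    using card_le_card_imp_periodic[of ?e ?f N "Suc k"] step by blast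
  \<comment> \<open>The margin \<open>2 * n\<close> covers both losses at the end: \<open>N\<close>
    is \<open>length w - k\<close>, and \<open>N'\<close> is at least \<open>N - Suc k\<close>, with
    \<open>Suc k\<close> at most \<open>n\<close>.\<close>
  have "w ! i = w ! (i + d)" if "n \<le> i" "i + d + 2 * n < length w" for i
  proof -
    have "?e i = ?e (i + d)" using that kn d by (intro per) (auto simp: N_def)
    then show ?thesis unfolding map_nth_upt_eq_iff by auto
  qed
  then show ?thesis using d kn by (intro exI[of _ d]) auto
qed

section \<open>Powers of 3\<close>

text \<open>The number \<open>X\<close> above the lowest \<open>s\<close> digits and its shift
  \<open>x'\<close> by \<open>d\<close> agree modulo \<open>2 ^ L\<close>. Eliminating
  \<open>x'\<close> with \<open>X = 2 ^ d * x' + r'\<close> gives the equation.\<close>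

lemma take_bit_drop_bit_eq:
  assumes "take_bit L (drop_bit s T) = take_bit L (drop_bit (s + d) T)"
  shows "\<exists>h::int. \<exists>A. (2 ^ d - 1) * int T = 2 ^ (L + d + s) * h + A
     \<and> 0 \<le> h \<and> \<bar>A\<bar> < 2 ^ (d + s) \<and> 2 ^ (L + d + s) * h \<le> 2 ^ d * int T"
proof -
  define X where "X = drop_bit s T"
  define r where "r = take_bit s T"
  define x' where "x' = drop_bit d X"
  define r' where "r' = take_bit d X"
  have split: "int Y = 2 ^ k * int (drop_bit k Y) + int (take_bit k Y)" for k Y :: nat
  proof -
    have "int Y = int (2 ^ k * drop_bit k Y + take_bit k Y)"
      unfolding drop_bit_eq_div take_bit_eq_mod by (simp only: mult_div_mod_eq)
    then show ?thesis by simp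
  qed
  have T: "int T = 2 ^ s * int X + int r" unfolding X_def r_def by (rule split)
  have X: "int X = 2 ^ d * int x' + int r'" unfolding x'_def r'_def by (rule split)
  have "take_bit L X = take_bit L x'"
    using assms by (simp add: X_def x'_def add.commute)
  then have dif: "int X - int x' = 2 ^ L * (int (drop_bit L X) - int (drop_bit L x'))"
    using split[of X L] split[of x' L] by (simp add: right_diff_distrib)
  define h where "h = int (drop_bit L X) - int (drop_bit L x')"
  \<comment> \<open>\<open>A\<close> collects the digits below \<open>s\<close> and the next
    \<open>d\<close> digits. It may be negative, but it is a difference of two nonnegative numbers
    below \<open>2 ^ (d + s)\<close>.\<close>
  define A where "A = (2 ^ d - 1) * int r - 2 ^ s * int r'"
  have "x' \<le> X" unfolding x'_def by (simp add: drop_bit_eq_div)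
  then have h0: "0 \<le> h"
    using dif unfolding h_def by (simp add: drop_bit_eq_div div_le_mono)
  have rr: "int r < 2 ^ s" "int r' < 2 ^ d"
    unfolding r_def r'_def by (simp_all add: of_nat_take_bit)
  have eq: "(2 ^ d - 1) * int T = 2 ^ (L + d + s) * h + A"
  proof -
    have "2 ^ d * (2 ^ L * h) = 2 ^ d * int X - (int X - int r')"
    proof -
      have "2 ^ d * (2 ^ L * h) = 2 ^ d * (int X - int x')" using dif by (simp add: h_def)
      also have "\<dots> = 2 ^ d * int X - 2 ^ d * int x'" by (rule right_diff_distrib)
      finally show ?thesis using X by linarith
    qed
    then have "2 ^ d * (2 ^ L * h) = (2 ^ d - 1) * int X + int r'"
      by (simp add: left_diff_distrib)
    then have "2 ^ s * (2 ^ d * (2 ^ L * h)) = 2 ^ s * ((2 ^ d - 1) * int X + int r')"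
      by (simp only:)
    then show ?thesis unfolding A_def T by (simp add: power_add algebra_simps)
  qed
  have "\<bar>A\<bar> < 2 ^ (d + s)"
  proof -
    have "(2 ^ d - 1) * int r \<le> (2 ^ d - 1) * 2 ^ s"
      using rr by (intro mult_left_mono) auto
    also have "\<dots> < 2 ^ (d + s)" by (simp add: power_add algebra_simps)
    finally have "(2 ^ d - 1) * int r < 2 ^ (d + s)" .
    moreover have "2 ^ s * int r' < 2 ^ (d + s)"
      using rr by (simp add: power_add)
    moreover have "0 \<le> (2 ^ d - 1) * int r" "0 \<le> 2 ^ s * int r'" by simp_all
    ultimately show ?thesis unfolding A_def by linarith
  qed
  moreover have "2 ^ (L + d + s) * h \<le> 2 ^ d * int T"
  proof -
    have "2 ^ L * h \<le> int X" using dif by (simp add: h_def)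
    then have "2 ^ (d + s) * (2 ^ L * h) \<le> 2 ^ (d + s) * int X" by (intro mult_left_mono) auto
    also have "\<dots> \<le> 2 ^ d * int T" by (simp add: T power_add algebra_simps)
    finally show ?thesis by (simp add: power_add mult_ac)
  qed
  ultimately show ?thesis using eq h0 by blast
qed

text \<open>The approximate period of the word enters \<open>take_bit_drop_bit_eq\<close> with
  \<open>s = n\<close>. The bounds on \<open>d\<close>, \<open>A\<close> and \<open>h\<close> depend
  on \<open>n\<close> alone, and the last inequality keeps \<open>2 ^ t\<close> comparable to
  \<open>T\<close>.\<close>

lemma low_complexity_imp_exponential_equation:
  assumes n: "1 \<le> n" and low: "subword_complexity (binary_word T) n \<le> n"
    and T: "2 ^ (5 * n) \<le> T"
  shows "\<exists>d A h t. 1 \<le> d \<and> d \<le> n \<and> (2 ^ d - 1) * int T = h * 2 ^ t + A \<and> \<bar>A\<bar> < 4 ^ n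
    \<and> 0 \<le> h \<and> h < 2 ^ (5 * n) \<and> T < 2 ^ (t + 5 * n)"
proof -
  define M where "M = nat \<lfloor>log 2 (real T)\<rfloor>"
  have T0: "0 < T" using T by (metis gr0I not_numeral_le_zero power_not_zero le_zero_eq zero_neq_numeral)
  have M: "2 ^ M \<le> T" "T < 2 ^ (M + 1)"
  proof -
    have "0 \<le> log 2 (real T)" using T0 by simp
    then have M1: "real M \<le> log 2 (real T)" "log 2 (real T) < real (M + 1)"
      unfolding M_def by linarith+
    then have "2 powr real M \<le> real T" "real T < 2 powr real (M + 1)"
      using T0 by (simp_all add: le_log_iff log_less_iff)
    then have "real (2 ^ M) \<le> real T" "real T < real (2 ^ (M + 1))"
      unfolding powr_realpow[OF zero_less_numeral] by simp_all
    then show "2 ^ M \<le> T" "T < 2 ^ (M + 1)" by (simp_all only: of_nat_le_iff of_nat_less_iff)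
  qed
  have len: "length (binary_word T) = M" by (simp add: binary_word_def M_def)
  have nth: "binary_word T ! i = of_bool (bit T i)" if "i < M" for i
    using that by (simp add: binary_word_def M_def)
  have "5 * n < M + 1"
    using T M(2) by (metis le_less_trans nat_power_less_imp_less pos2)
  then have Mn: "5 * n \<le> M" by simp
  obtain d where d: "1 \<le> d" "d \<le> n"
    and per: "\<And>i. n \<le> i \<Longrightarrow> i + d + 2 * n < M \<Longrightarrow> binary_word T ! i = binary_word T ! (i + d)"
    using low_complexity_imp_periodic[OF n low] Mn n unfolding len by auto
  \<comment> \<open>The number of consecutive positions from \<open>n\<close> on at which the period
    is guaranteed.\<close>
  define L where "L = M - (3 * n + d)"
  have bits: "bit T i = bit T (i + d)" if "n \<le> i" "i + d + 2 * n < M" for i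
    using per[OF that] that by (simp add: nth of_bool_eq_iff)
  have "take_bit L (drop_bit n T) = take_bit L (drop_bit (n + d) T)"
  proof (rule bit_eqI)
    fix i
    show "bit (take_bit L (drop_bit n T)) i = bit (take_bit L (drop_bit (n + d) T)) i"
      using bits[of "n + i"] by (auto simp: bit_take_bit_iff bit_drop_bit_eq L_def add_ac)
  qed
  from take_bit_drop_bit_eq[OF this] obtain h A where hA:
    "(2 ^ d - 1) * int T = 2 ^ (L + d + n) * h + A" "0 \<le> h" "\<bar>A\<bar> < 2 ^ (d + n)"
    "2 ^ (L + d + n) * h \<le> 2 ^ d * int T" by blast
  have t: "L + d + n = M - 2 * n" using d Mn by (simp add: L_def)
  have "(2::int) ^ (d + n) \<le> 2 ^ (2 * n)" using d by (intro power_increasing) auto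
  then have A: "\<bar>A\<bar> < 4 ^ n" using hA(3) by (simp add: power_mult)
  have "int T < 2 ^ (M + 1)" using M(2) by (metis of_nat_less_iff of_nat_numeral of_nat_power)
  then have "2 ^ (M - 2 * n) * h < 2 ^ d * 2 ^ (M + 1)"
    using hA(4) unfolding t by (meson le_less_trans mult_strict_left_mono zero_less_numeral zero_less_power)
  also have "\<dots> = 2 ^ (M - 2 * n) * 2 ^ (2 * n + d + 1)"
    using Mn by (simp flip: power_add)
  finally have "h < 2 ^ (2 * n + d + 1)" by simp
  also have "\<dots> \<le> 2 ^ (5 * n)" using d n by (intro power_increasing) auto
  finally have h: "h < 2 ^ (5 * n)" .
  have "(2::nat) ^ (M + 1) \<le> 2 ^ (M - 2 * n + 5 * n)" using n by (intro power_increasing) auto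
  then have "T < 2 ^ (M - 2 * n + 5 * n)" using M(2) by linarith
  then show ?thesis using d hA(1,2) A h unfolding t by (metis mult.commute)
qed

text \<open>For \<open>A = 0\<close>, coprimality gives \<open>2 ^ t dvd c\<close>, so
  \<open>t\<close> is bounded and the size condition bounds \<open>m\<close>. For
  \<open>h = 0\<close> the size or sign of \<open>A\<close> decides; the other cases reduce to
  \<open>finite_exponential_solutions\<close>.\<close>

lemma finite_three_power_near_two_power:
  fixes c h A :: int
  assumes c: "0 < c" and h: "0 \<le> h"
  shows "finite {m. \<exists>t. c * 3 ^ m = h * 2 ^ t + A \<and> (3::nat) ^ m < 2 ^ (t + k)}"
    (is "finite ?S")
proof -
  obtain c' h' where ch: "c = int c'" "h = int h'" "0 < c'"
    using c h by (metis nonneg_int_cases less_imp_le of_nat_0_less_iff)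
  consider "A = 0" | "A > 0" "h = 0" | "A > 0" "h > 0" | "A < 0" "h = 0" | "A < 0" "h > 0"
    using h by linarith
  then show ?thesis
  proof cases
    case 1
    have "m < nat c + k" if "m \<in> ?S" for m
    proof -
      obtain t where "c * 3 ^ m = h * 2 ^ t + A" and less: "(3::nat) ^ m < 2 ^ (t + k)"
        using \<open>m \<in> ?S\<close> by blast
      then have t: "c * 3 ^ m = h * 2 ^ t" using 1 by simp
      have "2 ^ t dvd c * 3 ^ m" using t by simp
      moreover have "coprime ((2::int) ^ t) (3 ^ m)" by simp
      ultimately have "2 ^ t dvd c" by (simp add: coprime_dvd_mult_left_iff)
      then have "2 ^ t \<le> c" using c zdvd_imp_le by blast
      moreover have "int t < 2 ^ t" by (metis less_exp of_nat_less_iff of_nat_numeral of_nat_power)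
      ultimately have "t < nat c" by linarith
      moreover have "(2::nat) ^ m \<le> 3 ^ m" by (intro power_mono) auto
      then have "(2::nat) ^ m < 2 ^ (t + k)" using less by linarith
      then have "m < t + k" by simp
      ultimately show ?thesis by linarith
    qed
    then show ?thesis by (meson finite_nat_set_iff_bounded)
  next
    case 2
    have "m < nat A" if "m \<in> ?S" for m
    proof -
      have "int m < int (3 ^ m)"
        unfolding of_nat_less_iff by (rule power_gt_expt) simp
      then have "int m < 3 ^ m" by (simp only: of_nat_power of_nat_numeral)
      moreover have "c * 3 ^ m = A" using that 2 by auto
      moreover have "1 * 3 ^ m \<le> c * 3 ^ m" using c by (intro mult_right_mono) auto
      ultimately show ?thesis by linarith
    qed
    then show ?thesis by (meson finite_nat_set_iff_bounded)
  next
    case 3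
    have "?S \<subseteq> fst ` {(m, t). c' * 3 ^ m = h' * 2 ^ t + nat A}"
    proof
      fix m assume "m \<in> ?S"
      then obtain t where "c * 3 ^ m = h * 2 ^ t + A" by blast
      then have "int (c' * 3 ^ m) = int (h' * 2 ^ t + nat A)" using 3 by (simp add: ch)
      then have "c' * 3 ^ m = h' * 2 ^ t + nat A" by (simp only: of_nat_eq_iff)
      then show "m \<in> fst ` {(m, t). c' * 3 ^ m = h' * 2 ^ t + nat A}" by force
    qed
    moreover have "finite {(m, t). c' * 3 ^ m = h' * 2 ^ t + nat A}"
      using 3 ch by (intro finite_exponential_solutions) auto
    ultimately show ?thesis by (meson finite_imageI finite_subset)
  next
    case 4
    have "c * 3 ^ m \<noteq> h * 2 ^ t + A" for m t
    proof -
      have "0 < c * 3 ^ m" using c by simp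
      then show ?thesis using 4 by simp
    qed
    then show ?thesis by simp
  next
    case 5
    \<comment> \<open>A negative \<open>A\<close> changes sides, exchanging the powers of 2 and 3,
      so that the constant is positive.\<close>
    have "?S \<subseteq> snd ` {(t, m). h' * 2 ^ t = c' * 3 ^ m + nat (- A)}"
    proof
      fix m assume "m \<in> ?S"
      then obtain t where "c * 3 ^ m = h * 2 ^ t + A" by blast
      then have "int (h' * 2 ^ t) = int (c' * 3 ^ m + nat (- A))" using 5 by (simp add: ch)
      then have "h' * 2 ^ t = c' * 3 ^ m + nat (- A)" by (simp only: of_nat_eq_iff)
      then show "m \<in> snd ` {(t, m). h' * 2 ^ t = c' * 3 ^ m + nat (- A)}" by force
    qed
    moreover have "finite {(t, m). h' * 2 ^ t = c' * 3 ^ m + nat (- A)}"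
      using 5 ch by (intro finite_exponential_solutions) auto
    ultimately show ?thesis by (meson finite_imageI finite_subset)
  qed
qed

theorem theorem2:
  shows "\<forall>n::nat. n \<ge> 1 \<longrightarrow>
    (\<exists>m0::nat. \<forall>m\<ge>m0. subword_complexity (binary_word (3 ^ m)) n \<ge> n + 1)"
proof (intro allI impI)
  fix n :: nat
  assume n: "n \<ge> 1"
  \<comment> \<open>Exponents of low complexity lie in one of these sets; each is finite, and
    \<open>n\<close> leaves finitely many triples.\<close>
  define S where "S d h A = {m. \<exists>t. (2 ^ d - 1) * 3 ^ m = h * 2 ^ t + A \<and> (3::nat) ^ m < 2 ^ (t + 5 * n)}"
    for d :: nat and h A :: int
  let ?U = "\<Union>d\<in>{1..n}. \<Union>h\<in>{0..<2 ^ (5 * n)}. \<Union>A\<in>{- (4 ^ n)..4 ^ n}. S d h A"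
  have "finite (S d h A)" if "1 \<le> d" "0 \<le> h" for d h A
  proof -
    have "(1::int) < 2 ^ d" using that by simp
    then show ?thesis
      unfolding S_def using that by (intro finite_three_power_near_two_power) auto
  qed
  then have "finite ?U" by (intro finite_UN_I) auto
  then obtain m1 where m1: "\<And>m. m \<in> ?U \<Longrightarrow> m < m1" by (meson finite_nat_set_iff_bounded)
  show "\<exists>m0. \<forall>m\<ge>m0. n + 1 \<le> subword_complexity (binary_word (3 ^ m)) n"
  \<comment> \<open>\<open>m1\<close> lies beyond all exceptional exponents; \<open>5 * n\<close>
    ensures that \<open>3 ^ m\<close> is at least \<open>2 ^ (5 * n)\<close>.\<close>
  proof (intro exI[of _ "max m1 (5 * n)"] allI impI, rule ccontr)
    fix m assume m: "max m1 (5 * n) \<le> m" and "\<not> n + 1 \<le> subword_complexity (binary_word (3 ^ m)) n"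
    then have low: "subword_complexity (binary_word (3 ^ m)) n \<le> n" by simp
    have "(2::nat) ^ (5 * n) \<le> 2 ^ m" using m by (intro power_increasing) auto
    also have "\<dots> \<le> 3 ^ m" by (intro power_mono) auto
    finally have "2 ^ (5 * n) \<le> (3::nat) ^ m" .
    from low_complexity_imp_exponential_equation[OF n low this]
    obtain d A h t where "1 \<le> d" "d \<le> n" "(2 ^ d - 1) * int (3 ^ m) = h * 2 ^ t + A" "\<bar>A\<bar> < 4 ^ n"
      "0 \<le> h" "h < 2 ^ (5 * n)" "(3::nat) ^ m < 2 ^ (t + 5 * n)" by blast
    then have "m \<in> S d h A" "d \<in> {1..n}" "h \<in> {0..<2 ^ (5 * n)}" "A \<in> {- (4 ^ n)..4 ^ n}"
      by (auto simp: S_def)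
    then have "m \<in> ?U" by blast
    then show False using m1 m by fastforce
  qed
qed

end
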